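(* Let $n\geq 2$. For every integer $k$ with $0\leq k\leq (n-2)!$ there exists a u-word for $n$-permutations with incomparable elements at distance $n-1$ (in the sense defined in the context) of length $n!+(1-k)(n-1)$. In other words, such u-words exist of each of the lengths $n!+n-1,\ n!,\ n!-(n-1),\ \ldots,\ n!-(n-1)!+n-1$.
   Context: An $n$-permutation is a permutation $\pi=\pi_1\cdots\pi_n$ of $\{1,\ldots,n\}$. Let $w=w_1\cdots w_n$ be a word of length $n$ over the positive integers, where letters may repeat; equal letters are treated as incomparable. The word $w$ covers the $n$-permutation $\pi$ if for all $i,j\in\{1,\ldots,n\}$, $w_i<w_j$ implies $\pi_i<\pi_j$ (that is, $\pi$ is a linear extension of the partial order on positions induced by $w$, in which positions holding equal letters are incomparable). For example, $112$ covers $123$ and $213$. A u-word (universal word) for $n$-permutations is a finite word $u=u_1\cdots u_N$ over the positive integers with $N\geq n$ such that every $n$-permutation is covered by exactly one of the $N-n+1$ factors $u_iu_{i+1}\cdots u_{i+n-1}$, $1\leq i\leq N-n+1$. The u-word uses incomparable elements at distance $n-1$ if whenever $u_i=u_j$ with $i<j$, we have $j-i\geq n-1$ (so inside any factor of length $n$ only the first and last letters can be equal). *)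

theory Defs
  imports Main
begin

definition is_perm :: "nat \<Rightarrow> nat list \<Rightarrow> bool" where
  "is_perm n p \<longleftrightarrow> length p = n \<and> distinct p \<and> set p = {1..n}"

definition covers :: "nat list \<Rightarrow> nat list \<Rightarrow> bool" where
  "covers w p \<longleftrightarrow> length w = length p \<and>
     (\<forall>i < length w. \<forall>j < length w. w ! i < w ! j \<longrightarrow> p ! i < p ! j)"

definition factor :: "nat list \<Rightarrow> nat \<Rightarrow> nat \<Rightarrow> nat list" where
  "factor u n i = take n (drop i u)"

definition is_uword :: "nat \<Rightarrow> nat list \<Rightarrow> bool" where
  "is_uword n u \<longleftrightarrow> length u \<ge> n \<and> (\<forall>x \<in> set u. x > 0) \<and>
     (\<forall>p. is_perm n p \<longrightarrow>
        (\<exists>!i. i \<le> length u - n \<and> covers (factor u n i) p))"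

definition incomp_dist :: "nat \<Rightarrow> nat list \<Rightarrow> bool" where
  "incomp_dist n u \<longleftrightarrow>
     (\<forall>i j. i < j \<and> j < length u \<and> u ! i = u ! j \<longrightarrow> j - i \<ge> n - 1)"

end

theory Submission
  imports Defs "Graph_Theory.Euler" "HOL-Combinatorics.Multiset_Permutations"
begin

text \<open>
  Let \<open>m = n - 1\<close>. Consider the digraph whose vertices are the \<open>m\<close>-permutations and whose arcs are the
  \<open>n\<close>-permutations, each leading from the pattern of its first \<open>m\<close> letters to that of its last \<open>m\<close> letters.
  Every vertex \<open>s\<close> has exactly two arcs to its rotation \<open>rotate1 s\<close>: the appended letter lies just below or
  just above the first one. A factor whose first and last letters are equal covers exactly the two
  permutations of such a double arc. The \<open>m\<close>-permutations fall into \<open>(n - 2)!\<close> rotation classes of size \<open>m\<close>.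
  Merging the double arcs at all vertices of \<open>k\<close> of these classes lowers each of their in- and out-degrees
  by one, so the graph stays balanced; it also stays strongly connected. Hence it has a closed Euler trail,
  of length \<open>n! - k m\<close>. Reading the trail as a word, with a repeated letter for each merged arc, adds \<open>m\<close>
  letters.
\<close>

section \<open>Permutations and order patterns\<close>

definition close_gap :: "nat \<Rightarrow> nat list \<Rightarrow> nat list" where
  "close_gap c xs = map (\<lambda>x. if c < x then x - 1 else x) xs"

definition open_gap :: "nat \<Rightarrow> nat list \<Rightarrow> nat list" where
  "open_gap c xs = map (\<lambda>x. if c \<le> x then Suc x else x) xs"

lemma length_close_gap [simp]: "length (close_gap c xs) = length xs"
  by (simp add: close_gap_def)

lemma length_open_gap [simp]: "length (open_gap c xs) = length xs"
  by (simp add: open_gap_def)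

lemma close_open_gap [simp]: "close_gap c (open_gap c xs) = xs"
  by (simp add: close_gap_def open_gap_def map_idI)

lemma open_close_gap: "c \<notin> set xs \<Longrightarrow> open_gap c (close_gap c xs) = xs"
  by (auto simp: close_gap_def open_gap_def intro!: map_idI)

lemma open_gap_less: "i < length xs \<Longrightarrow> j < length xs \<Longrightarrow> open_gap c xs ! i < open_gap c xs ! j \<longleftrightarrow> xs ! i < xs ! j"
  by (auto simp: open_gap_def)

lemma open_gap_less_gap: "i < length xs \<Longrightarrow> open_gap c xs ! i < c \<longleftrightarrow> xs ! i < c"
  by (auto simp: open_gap_def)

lemma close_gap_less:
  "c \<notin> set xs \<Longrightarrow> i < length xs \<Longrightarrow> j < length xs \<Longrightarrow> close_gap c xs ! i < close_gap c xs ! j \<longleftrightarrow> xs ! i < xs ! j"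
  using open_gap_less[of i "close_gap c xs" j c] by (simp add: open_close_gap)

lemma set_open_gap:
  assumes "set xs = {1..n}" "1 \<le> c" "c \<le> Suc n"
  shows "set (open_gap c xs) = {1..Suc n} - {c}"
proof -
  have "y \<in> (\<lambda>x. if c \<le> x then Suc x else x) ` {1..n}" if "y \<in> {1..Suc n} - {c}" for y
    using that assms(2,3) by (intro image_eqI[of _ _ "if c < y then y - 1 else y"]) auto
  then have "{1..Suc n} - {c} \<subseteq> set (open_gap c xs)"
    unfolding open_gap_def set_map assms(1) by blast
  moreover have "set (open_gap c xs) \<subseteq> {1..Suc n} - {c}"
    using assms by (auto simp: open_gap_def)
  ultimately show ?thesis by blast
qed

lemma set_close_gap:
  assumes "set xs = {1..Suc n} - {c}" "1 \<le> c" "c \<le> Suc n"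
  shows "set (close_gap c xs) = {1..n}"
proof -
  have "y \<in> (\<lambda>x. if c < x then x - 1 else x) ` ({1..Suc n} - {c})" if "y \<in> {1..n}" for y
    using that assms(2,3) by (intro image_eqI[of _ _ "if c \<le> y then Suc y else y"]) auto
  then have "{1..n} \<subseteq> set (close_gap c xs)"
    unfolding close_gap_def set_map assms(1) by blast
  moreover have "set (close_gap c xs) \<subseteq> {1..n}"
    unfolding close_gap_def set_map assms(1) using assms(2,3) by (intro image_subsetI) auto
  ultimately show ?thesis by blast
qed

lemma distinct_open_gap [simp]: "distinct (open_gap c xs) = distinct xs"
  by (auto simp: open_gap_def distinct_map inj_on_def split: if_splits)

lemma distinct_close_gap: "distinct xs \<Longrightarrow> c \<notin> set xs \<Longrightarrow> distinct (close_gap c xs)"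
  using distinct_open_gap[of c "close_gap c xs"] by (simp add: open_close_gap)

lemma gap_notin_open_gap [simp]: "c \<notin> set (open_gap c xs)"
  by (auto simp: open_gap_def)

text \<open>An (m+1)-permutation amounts to its last letter together with the pattern of the rest;
  this parametrizes the arcs leaving a vertex.\<close>

lemma is_perm_snoc:
  "is_perm (Suc m) (xs @ [c]) \<longleftrightarrow>
     1 \<le> c \<and> c \<le> Suc m \<and> c \<notin> set xs \<and> is_perm m (close_gap c xs)"
proof
  assume "is_perm (Suc m) (xs @ [c])"
  then have "length xs = m" "distinct xs" "c \<notin> set xs" "insert c (set xs) = {1..Suc m}"
    by (auto simp: is_perm_def)
  moreover from this have "set xs = {1..Suc m} - {c}" "1 \<le> c" "c \<le> Suc m"
    by auto
  ultimately show "1 \<le> c \<and> c \<le> Suc m \<and> c \<notin> set xs \<and> is_perm m (close_gap c xs)"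
    using set_close_gap distinct_close_gap by (auto simp: is_perm_def)
next
  assume *: "1 \<le> c \<and> c \<le> Suc m \<and> c \<notin> set xs \<and> is_perm m (close_gap c xs)"
  then have "set (open_gap c (close_gap c xs)) = {1..Suc m} - {c}"
    "distinct (open_gap c (close_gap c xs))"
    by (intro set_open_gap, auto simp: is_perm_def)
  then have "set xs = {1..Suc m} - {c}" "distinct xs"
    using * open_close_gap[of c xs] by auto
  with * show "is_perm (Suc m) (xs @ [c])"
    by (auto simp: is_perm_def)
qed

lemma is_perm_rotate1 [simp]: "is_perm n (rotate1 xs) = is_perm n xs"
  by (simp add: is_perm_def)

lemma is_perm_Cons:
  "is_perm (Suc m) (c # xs) \<longleftrightarrow>
     1 \<le> c \<and> c \<le> Suc m \<and> c \<notin> set xs \<and> is_perm m (close_gap c xs)"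
  using is_perm_snoc[of m xs c] is_perm_rotate1[of "Suc m" "c # xs"] by simp

lemma perms_eq_permutations_of_set: "{p. is_perm n p} = permutations_of_set {1..n}"
  by (auto simp: is_perm_def permutations_of_set_def dest: distinct_card)

lemma finite_perms [simp]: "finite {p. is_perm n p}"
  by (simp add: perms_eq_permutations_of_set)

lemma card_perms: "card {p. is_perm n p} = fact n"
  by (simp add: perms_eq_permutations_of_set)

text \<open>A letter of a permutation is its own rank, so a permutation can be recovered from its
  order relations.\<close>

lemma perm_nth_eq_card:
  assumes "is_perm n p" "i < n"
  shows "p ! i = card {j. j < n \<and> p ! j \<le> p ! i}"
proof -
  have p: "length p = n" "distinct p" "set p = {1..n}"
    using assms(1) by (auto simp: is_perm_def)
  have "(!) p ` {j. j < n \<and> p ! j \<le> p ! i} = {y \<in> set p. y \<le> p ! i}"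
    using p(1) by (auto simp: in_set_conv_nth)
  also have "\<dots> = {1..p ! i}"
    using p nth_mem[of i p] assms(2) by auto
  finally have "card ((!) p ` {j. j < n \<and> p ! j \<le> p ! i}) = p ! i"
    by simp
  moreover have "inj_on ((!) p) {j. j < n \<and> p ! j \<le> p ! i}"
    using p by (auto simp: inj_on_def nth_eq_iff_index_eq)
  ultimately show ?thesis
    by (simp add: card_image)
qed

lemma perm_nth_eq_iff: "is_perm n p \<Longrightarrow> i < n \<Longrightarrow> j < n \<Longrightarrow> p ! i = p ! j \<longleftrightarrow> i = j"
  by (auto simp: is_perm_def nth_eq_iff_index_eq)

text \<open>Both permutations order the positions totally, so containment of one order in the other
  forces equality; equal orders give equal ranks.\<close>

lemma covers_perm_imp_eq:
  assumes a: "is_perm n a" and p: "is_perm n p" and c: "covers a p"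
  shows "a = p"
proof (rule nth_equalityI)
  show "length a = length p"
    using a p by (simp add: is_perm_def)
  fix i assume "i < length a"
  then have i: "i < n"
    using a by (simp add: is_perm_def)
  have lt: "a ! j < a ! k \<Longrightarrow> p ! j < p ! k" if "j < n" "k < n" for j k
    using c a that by (auto simp: covers_def is_perm_def)
  have "a ! j \<le> a ! i \<longleftrightarrow> p ! j \<le> p ! i" if "j < n" for j
    using lt[OF that i] lt[OF i that] perm_nth_eq_iff[OF a that i] perm_nth_eq_iff[OF p that i]
    by (cases "a ! j" "a ! i" rule: linorder_cases) auto
  then have "{j. j < n \<and> a ! j \<le> a ! i} = {j. j < n \<and> p ! j \<le> p ! i}"
    by auto
  then show "a ! i = p ! i"
    using perm_nth_eq_card[OF a i] perm_nth_eq_card[OF p i] by simp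
qed

section \<open>Order isomorphism of words\<close>

definition same_order :: "nat list \<Rightarrow> nat list \<Rightarrow> bool" where
  "same_order w v \<longleftrightarrow> length w = length v \<and>
     (\<forall>i < length w. \<forall>j < length w. w ! i < w ! j \<longleftrightarrow> v ! i < v ! j)"

lemma same_order_trans: "same_order u v \<Longrightarrow> same_order v w \<Longrightarrow> same_order u w"
  by (auto simp: same_order_def)

lemma same_order_sym: "same_order w v \<Longrightarrow> same_order v w"
  by (auto simp: same_order_def)

lemma same_order_drop: "same_order w v \<Longrightarrow> same_order (drop k w) (drop k v)"
  by (auto simp: same_order_def)

lemma same_order_snoc:
  assumes "same_order w v"
    and "\<And>i. i < length w \<Longrightarrow> w ! i < c \<longleftrightarrow> v ! i < d"
    and "\<And>i. i < length w \<Longrightarrow> c < w ! i \<longleftrightarrow> d < v ! i"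
  shows "same_order (w @ [c]) (v @ [d])"
  using assms by (auto simp: same_order_def nth_append less_Suc_eq)

lemma same_order_perm_imp_eq: "is_perm n a \<Longrightarrow> is_perm n p \<Longrightarrow> same_order a p \<Longrightarrow> a = p"
  by (rule covers_perm_imp_eq) (auto simp: same_order_def covers_def)

lemma same_order_close_gap: "c \<notin> set xs \<Longrightarrow> same_order (close_gap c xs) xs"
  by (simp add: same_order_def close_gap_less)

text \<open>The positions where \<open>v\<close> lies below \<open>y\<close> form a down-closed set
  in the common order, so a value just above the largest letter of \<open>w\<close> on that set cuts
  \<open>w\<close> in the same place.\<close>

lemma same_order_threshold:
  assumes "same_order w v" "\<And>x. x \<in> set w \<Longrightarrow> 0 < x \<and> x \<le> b"
  shows "\<exists>x. 0 < x \<and> x \<le> Suc b \<and> (\<forall>i < length w. w ! i < x \<longleftrightarrow> v ! i < y)"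
proof -
  \<comment> \<open>The extra \<open>0\<close> covers the case that no letter of \<open>v\<close>
    lies below \<open>y\<close>; the threshold is then 1.\<close>
  define S where "S = insert 0 ((!) w ` {i. i < length w \<and> v ! i < y})"
  have fin: "finite S" "S \<noteq> {}" by (auto simp: S_def)
  have "w ! i < Suc (Max S) \<longleftrightarrow> v ! i < y" if i: "i < length w" for i
  proof
    assume "v ! i < y"
    then have "w ! i \<in> S" using i by (auto simp: S_def)
    then show "w ! i < Suc (Max S)" using fin by (simp add: less_Suc_eq_le)
  next
    assume "w ! i < Suc (Max S)"
    then have le: "w ! i \<le> Max S" by simp
    have "Max S \<in> S" using fin by (rule Max_in)
    moreover have "0 < w ! i" using assms(2) i by auto
    ultimately obtain j where j: "j < length w" "v ! j < y" "Max S = w ! j"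
      using le by (auto simp: S_def)
    then have "\<not> v ! j < v ! i"
      using assms(1) i le by (metis leD same_order_def)
    then show "v ! i < y" using j by simp
  qed
  moreover have "Max S \<le> b"
    using fin assms(2) by (auto simp: S_def)
  ultimately show ?thesis
    by (intro exI[of _ "Suc (Max S)"]) auto
qed

section \<open>The overlap graph with merged arcs\<close>

definition arc_source :: "nat list \<Rightarrow> nat list" where
  "arc_source a = close_gap (last a) (butlast a)"

definition arc_target :: "nat list \<Rightarrow> nat list" where
  "arc_target a = close_gap (hd a) (tl a)"

lemma is_perm_arc_source:
  assumes "is_perm (Suc m) a" shows "is_perm m (arc_source a)"
proof -
  have "a = butlast a @ [last a]"
    using assms by (cases a rule: rev_cases) (auto simp: is_perm_def)
  then show ?thesis
    using assms is_perm_snoc[of m "butlast a" "last a"] by (simp add: arc_source_def)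
qed

lemma is_perm_arc_target:
  assumes "is_perm (Suc m) a" shows "is_perm m (arc_target a)"
  using assms by (cases a) (auto simp: arc_target_def is_perm_Cons, simp add: is_perm_def)

lemma perm_arc_source_iff:
  "is_perm (Suc m) a \<and> arc_source a = s \<longleftrightarrow>
     is_perm m s \<and> (\<exists>c \<in> {1..Suc m}. a = open_gap c s @ [c])"
proof (cases a rule: rev_cases)
  case (snoc xs c)
  show ?thesis
  proof (intro iffI; elim conjE bexE)
    assume "is_perm (Suc m) a" "arc_source a = s"
    then show "is_perm m s \<and> (\<exists>c \<in> {1..Suc m}. a = open_gap c s @ [c])"
      using snoc by (simp add: arc_source_def is_perm_snoc) (metis open_close_gap)
  next
    fix c assume "is_perm m s" "c \<in> {1..Suc m}" "a = open_gap c s @ [c]"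
    then show "is_perm (Suc m) a \<and> arc_source a = s"
      by (simp add: arc_source_def is_perm_snoc)
  qed
qed (simp add: is_perm_def)

lemma perm_arc_target_iff:
  "is_perm (Suc m) a \<and> arc_target a = t \<longleftrightarrow>
     is_perm m t \<and> (\<exists>c \<in> {1..Suc m}. a = c # open_gap c t)"
proof (cases a)
  case (Cons c xs)
  show ?thesis
  proof (intro iffI; elim conjE bexE)
    assume "is_perm (Suc m) a" "arc_target a = t"
    then show "is_perm m t \<and> (\<exists>c \<in> {1..Suc m}. a = c # open_gap c t)"
      using Cons by (simp add: arc_target_def is_perm_Cons) (metis open_close_gap)
  next
    fix c assume "is_perm m t" "c \<in> {1..Suc m}" "a = c # open_gap c t"
    then show "is_perm (Suc m) a \<and> arc_target a = t"
      by (simp add: arc_target_def is_perm_Cons)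
  qed
qed (simp add: is_perm_def)

section \<open>The two arcs of a double arc\<close>

definition swap_ends :: "nat list \<Rightarrow> nat list" where
  "swap_ends a = last a # butlast (tl a) @ [hd a]"

lemma ends_cases:
  assumes "is_perm (Suc m) a" "0 < m"
  obtains x ys z where "a = x # ys @ [z]" "length ys = m - 1"
proof -
  have l: "length a = Suc m" using assms by (simp add: is_perm_def)
  then obtain x b where "a = x # b" by (cases a) auto
  moreover then obtain ys z where "b = ys @ [z]" using l assms(2) by (cases b rule: rev_cases) auto
  ultimately show thesis using that[of x ys z] l assms(2) by auto
qed

lemma nth_swap_ends:
  assumes "is_perm (Suc m) a" "0 < m" "i \<le> m"
  shows "swap_ends a ! i = (if i = 0 then a ! m else if i = m then a ! 0 else a ! i)"
proof -
  obtain x ys z where a: "a = x # ys @ [z]" "length ys = m - 1"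
    using ends_cases[OF assms(1,2)] .
  have "(w # ys @ [w']) ! i = (if i = 0 then w else if i = m then w' else ys ! (i - 1))" for w w'
    using a(2) assms(2,3) by (cases i) (auto simp: nth_append)
  from this[of z x] this[of x z] show ?thesis
    using a assms(2) by (simp add: swap_ends_def nth_append)
qed

lemma hd_swap_ends [simp]: "hd (swap_ends a) = last a"
  and last_swap_ends [simp]: "last (swap_ends a) = hd a"
  by (simp_all add: swap_ends_def)

lemma is_perm_swap_ends:
  assumes "is_perm (Suc m) a" "0 < m"
  shows "is_perm (Suc m) (swap_ends a)"
proof -
  obtain x ys z where "a = x # ys @ [z]" using ends_cases[OF assms] .
  then show ?thesis
    using assms(1) by (simp add: swap_ends_def is_perm_def insert_commute)
qed

lemma swap_swap_ends:
  assumes "is_perm (Suc m) a" "0 < m"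
  shows "swap_ends (swap_ends a) = a"
  by (rule ends_cases[OF assms]) (auto simp: swap_ends_def)

text \<open>When the ends are consecutive values, no inner letter separates them, so exchanging them
  yields a parallel arc.\<close>

lemma swap_ends_adjacent:
  assumes "is_perm (Suc m) a" "0 < m" "hd a = Suc (last a)"
  shows "arc_source (swap_ends a) = arc_source a" "arc_target (swap_ends a) = arc_target a"
proof -
  obtain x ys z where a: "a = x # ys @ [z]" using ends_cases[OF assms(1,2)] .
  with assms have "x = Suc z" "x \<notin> set ys" "z \<notin> set ys"
    by (auto simp: is_perm_def)
  then have "close_gap x ys = close_gap z ys"
    by (auto simp: close_gap_def) (metis Suc_lessI)
  then show "arc_source (swap_ends a) = arc_source a" "arc_target (swap_ends a) = arc_target a"
    using \<open>x = Suc z\<close>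
    by (auto simp: a swap_ends_def arc_source_def arc_target_def butlast_append)
       (auto simp: close_gap_def)
qed

text \<open>
  \<open>M\<close> is a union of rotation classes of patterns; out of the double arc from each pattern in \<open>M\<close> to
  its rotation, the graph keeps the \<open>tied\<close> arc, which stands for both, and drops the \<open>merged\<close> one.
\<close>

locale tie_classes =
  fixes m :: nat and M :: "nat list set"
  assumes m_pos: "0 < m"
    and is_perm_M: "s \<in> M \<Longrightarrow> is_perm m s"
    and rotate1_in_M: "rotate1 s \<in> M \<longleftrightarrow> s \<in> M"
begin

definition merged :: "nat list \<Rightarrow> bool" where
  "merged a \<longleftrightarrow> hd a = Suc (last a) \<and> arc_source a \<in> M"

definition tied :: "nat list \<Rightarrow> bool" where
  "tied a \<longleftrightarrow> last a = Suc (hd a) \<and> arc_source a \<in> M"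

definition overlap_graph :: "(nat list, nat list) pre_digraph" where
  "overlap_graph = \<lparr>verts = {s. is_perm m s}, arcs = {a. is_perm (Suc m) a \<and> \<not> merged a},
     tail = arc_source, head = arc_target\<rparr>"

lemma overlap_graph_sel [simp]:
  "verts overlap_graph = {s. is_perm m s}"
  "arcs overlap_graph = {a. is_perm (Suc m) a \<and> \<not> merged a}"
  "tail overlap_graph = arc_source" "head overlap_graph = arc_target"
  by (simp_all add: overlap_graph_def)

sublocale fin_digraph overlap_graph
proof
  show "finite (arcs overlap_graph)"
    by (rule finite_subset[OF _ finite_perms[of "Suc m"]]) auto
qed (auto intro: is_perm_arc_source is_perm_arc_target)

section \<open>Degrees and number of arcs\<close>

lemma perm_nonempty: "is_perm m s \<Longrightarrow> s \<noteq> []"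
  using m_pos by (auto simp: is_perm_def)

lemma hd_last_perm:
  assumes "is_perm m s"
  shows "hd s \<in> {1..Suc m}" "Suc (last s) \<in> {1..Suc m}"
proof -
  have "hd s \<in> {1..m}" "last s \<in> {1..m}"
    using hd_in_set[OF perm_nonempty[OF assms]] last_in_set[OF perm_nonempty[OF assms]] assms
    unfolding is_perm_def by blast+
  then show "hd s \<in> {1..Suc m}" "Suc (last s) \<in> {1..Suc m}"
    by simp_all
qed

text \<open>Appending \<open>c = hd s\<close> lifts the first letter to \<open>Suc c\<close>. No
  other \<open>c\<close> makes the first letter exceed the last by exactly one.\<close>

lemma merged_snoc_iff:
  assumes "is_perm m s"
  shows "merged (open_gap c s @ [c]) \<longleftrightarrow> s \<in> M \<and> c = hd s"
  using perm_nonempty[OF assms]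
  by (cases s) (auto simp: merged_def arc_source_def, auto simp: open_gap_def split: if_splits)

lemma merged_Cons_iff:
  assumes "is_perm m t"
  shows "merged (c # open_gap c t) \<longleftrightarrow> t \<in> M \<and> c = Suc (last t)"
proof -
  obtain ys y where t: "t = ys @ [y]"
    using perm_nonempty[OF assms] by (cases t rule: rev_cases) auto
  then have "y \<notin> set ys"
    using assms by (auto simp: is_perm_def)
  then have "close_gap y (open_gap (Suc y) ys) = ys"
    by (auto simp: close_gap_def open_gap_def intro!: map_idI)
  then have "arc_source (Suc y # open_gap (Suc y) t) = y # ys"
    by (simp add: t arc_source_def butlast_append open_gap_def close_gap_def)
  \<comment> \<open>Closure of \<open>M\<close> under rotation turns the condition on the source
    into one on the target; this is what keeps the graph balanced.\<close>
  moreover have "y # ys \<in> M \<longleftrightarrow> t \<in> M"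
    using rotate1_in_M[of "y # ys"] by (simp add: t)
  moreover have "c = Suc (last (c # open_gap c t)) \<longleftrightarrow> c = Suc y"
    by (auto simp: t open_gap_def)
  ultimately show ?thesis
    unfolding merged_def by (auto simp: t)
qed

lemma out_degree_overlap_graph:
  assumes "is_perm m s"
  shows "out_degree overlap_graph s = (if s \<in> M then m else Suc m)"
proof -
  have "out_arcs overlap_graph s = {a \<in> (\<lambda>c. open_gap c s @ [c]) ` {1..Suc m}. \<not> merged a}"
    using perm_arc_source_iff[of m _ s] assms
    unfolding out_arcs_def overlap_graph_sel by blast
  also have "\<dots> = (\<lambda>c. open_gap c s @ [c]) ` ({1..Suc m} - (if s \<in> M then {hd s} else {}))"
    using merged_snoc_iff[OF assms] by auto
  finally have "out_arcs overlap_graph s =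
      (\<lambda>c. open_gap c s @ [c]) ` ({1..Suc m} - (if s \<in> M then {hd s} else {}))" .
  moreover have "inj_on (\<lambda>c. open_gap c s @ [c]) A" for A
    by (auto simp: inj_on_def)
  ultimately show ?thesis
    using hd_last_perm(1)[OF assms]
    by (simp add: out_degree_def card_image card_Diff_singleton)
qed

lemma in_degree_overlap_graph:
  assumes "is_perm m t"
  shows "in_degree overlap_graph t = (if t \<in> M then m else Suc m)"
proof -
  have "in_arcs overlap_graph t = {a \<in> (\<lambda>c. c # open_gap c t) ` {1..Suc m}. \<not> merged a}"
    using perm_arc_target_iff[of m _ t] assms
    unfolding in_arcs_def overlap_graph_sel by blast
  also have "\<dots> = (\<lambda>c. c # open_gap c t) ` ({1..Suc m} - (if t \<in> M then {Suc (last t)} else {}))"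
    using merged_Cons_iff[OF assms] by auto
  finally have "in_arcs overlap_graph t =
      (\<lambda>c. c # open_gap c t) ` ({1..Suc m} - (if t \<in> M then {Suc (last t)} else {}))" .
  moreover have "inj_on (\<lambda>c. c # open_gap c t) A" for A
    by (auto simp: inj_on_def)
  ultimately show ?thesis
    using hd_last_perm(2)[OF assms]
    by (simp add: in_degree_def card_image card_Diff_singleton)
qed

text \<open>Each pattern in \<open>M\<close> is the source of exactly one merged arc.\<close>

lemma card_merged: "card {a. is_perm (Suc m) a \<and> merged a} = card M"
proof -
  have "{a. is_perm (Suc m) a \<and> merged a} = (\<lambda>s. open_gap (hd s) s @ [hd s]) ` M"
  proof (intro equalityI subsetI)
    fix a assume "a \<in> {a. is_perm (Suc m) a \<and> merged a}"
    then have a: "is_perm (Suc m) a" "merged a" by auto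
    then obtain c where c: "a = open_gap c (arc_source a) @ [c]" "is_perm m (arc_source a)"
      using perm_arc_source_iff[of m a "arc_source a"] by auto
    then have "arc_source a \<in> M" "c = hd (arc_source a)"
      using merged_snoc_iff[of "arc_source a" c] a(2) by simp_all
    with c(1) show "a \<in> (\<lambda>s. open_gap (hd s) s @ [hd s]) ` M"
      by auto
  next
    fix a assume "a \<in> (\<lambda>s. open_gap (hd s) s @ [hd s]) ` M"
    then obtain s where s: "s \<in> M" "a = open_gap (hd s) s @ [hd s]" by auto
    then have "is_perm (Suc m) a"
      using is_perm_M[OF s(1)] hd_last_perm(1)[OF is_perm_M[OF s(1)]]
      by (simp add: is_perm_snoc)
    with s show "a \<in> {a. is_perm (Suc m) a \<and> merged a}"
      using merged_snoc_iff[OF is_perm_M[OF s(1)], of "hd s"] by simp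
  qed
  moreover have "inj_on (\<lambda>s. open_gap (hd s) s @ [hd s]) M"
    by (rule inj_on_inverseI[of _ arc_source]) (simp add: arc_source_def)
  ultimately show ?thesis
    by (simp add: card_image)
qed

lemma card_arcs: "card (arcs overlap_graph) + card M = fact (Suc m)"
proof -
  have "fact (Suc m) = card ({a. is_perm (Suc m) a \<and> \<not> merged a} \<union> {a. is_perm (Suc m) a \<and> merged a})"
    unfolding card_perms[symmetric] by (rule arg_cong[of _ _ card]) auto
  also have "\<dots> = card {a. is_perm (Suc m) a \<and> \<not> merged a} + card {a. is_perm (Suc m) a \<and> merged a}"
    by (rule card_Un_disjoint) (auto intro: finite_subset[OF _ finite_perms[of "Suc m"]])
  finally show ?thesis
    by (simp add: card_merged)
qed

text \<open>Makes the Euler trail nonempty, so that the word read from it is at least as long as one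
  factor.\<close>

lemma arcs_nonempty: "arcs overlap_graph \<noteq> {}"
proof -
  have "is_perm (Suc m) [1..<Suc (Suc m)]"
    by (auto simp: is_perm_def)
  moreover have "\<not> merged [1..<Suc (Suc m)]"
    by (simp add: merged_def del: upt_Suc)
  ultimately show ?thesis
    unfolding overlap_graph_sel by blast
qed

section \<open>Strong connectivity\<close>

text \<open>A dropped arc has a parallel twin that is kept, so merging leaves adjacency
  unchanged.\<close>

lemma dominates_arc:
  assumes a: "is_perm (Suc m) a"
  shows "arc_source a \<rightarrow>\<^bsub>overlap_graph\<^esub> arc_target a"
proof (cases "merged a")
  case True
  then have adj: "hd a = Suc (last a)" by (simp add: merged_def)
  have "\<not> merged (swap_ends a)"
    using adj by (simp add: merged_def)
  then have "arc_source (swap_ends a) \<rightarrow>\<^bsub>overlap_graph\<^esub> arc_target (swap_ends a)"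
    using is_perm_swap_ends[OF a m_pos] by (intro dominatesI[of "swap_ends a"]) (auto simp: arc_to_ends_def)
  then show ?thesis
    by (simp add: swap_ends_adjacent[OF a m_pos adj])
next
  case False
  then show ?thesis
    using a by (intro dominatesI[of a]) (auto simp: arc_to_ends_def)
qed

text \<open>Spell out \<open>t\<close> letter by letter, each step matching one more letter of its pattern.\<close>

lemma reachable_suffix:
  assumes "is_perm m s" "is_perm m t" "i \<le> m"
  shows "\<exists>r. s \<rightarrow>\<^sup>*\<^bsub>overlap_graph\<^esub> r \<and> same_order (drop (m - i) r) (take i t)"
  using assms(3)
proof (induction i)
  case 0
  then show ?case
    using assms(1) by (intro exI[of _ s]) (auto simp: same_order_def is_perm_def)
next
  case (Suc i)
  then obtain r where r: "s \<rightarrow>\<^sup>*\<^bsub>overlap_graph\<^esub> r" "same_order (drop (m - i) r) (take i t)"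
    by auto
  have pr: "is_perm m r"
    using r(1) by (auto elim: reachable_in_vertsE)
  then have lr: "length r = m" by (simp add: is_perm_def)
  have lt: "length t = m" using assms(2) by (simp add: is_perm_def)
  have "0 < x \<and> x \<le> m" if "x \<in> set (drop (m - i) r)" for x
    using set_drop_subset[of "m - i" r] that pr by (auto simp: is_perm_def)
  \<comment> \<open>The letter \<open>x\<close> to append is chosen to cut the last \<open>i\<close>
    letters of \<open>r\<close> as \<open>t ! i\<close> cuts the first \<open>i\<close> letters of
    \<open>t\<close>.\<close>
  from same_order_threshold[OF r(2) this, of "t ! i"]
  obtain x where x: "0 < x" "x \<le> Suc m"
    "\<And>j. j < i \<Longrightarrow> r ! (m - i + j) < x \<longleftrightarrow> t ! j < t ! i"
    using lr Suc.prems by auto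
  define a where "a = open_gap x r @ [x]"
  have a: "is_perm (Suc m) a" "arc_source a = r"
    using perm_arc_source_iff[of m a r] pr x(1,2) by (auto simp: a_def)
  have "hd a \<notin> set (tl a)"
    using a(1) by (cases a) (auto simp: is_perm_def)
  then have "same_order (drop (m - Suc i) (arc_target a)) (drop (m - Suc i) (tl a))"
    unfolding arc_target_def by (intro same_order_drop same_order_close_gap)
  also have "drop (m - Suc i) (tl a) = drop (m - i) a"
    using Suc.prems by (simp add: drop_Suc[symmetric] Suc_diff_Suc)
  also have "\<dots> = drop (m - i) (open_gap x r) @ [x]"
    using lr by (simp add: a_def)
  finally have 1: "same_order (drop (m - Suc i) (arc_target a)) (drop (m - i) (open_gap x r) @ [x])" .
  have "same_order (drop (m - i) (open_gap x r)) (take i t)"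
    using r(2) lr by (auto simp: same_order_def open_gap_less)
  then have "same_order (drop (m - i) (open_gap x r) @ [x]) (take i t @ [t ! i])"
  proof (rule same_order_snoc)
    fix j assume "j < length (drop (m - i) (open_gap x r))"
    then have j: "j < i" "m - i + j < m"
      using lr Suc.prems by auto
    have less: "open_gap x r ! (m - i + j) < x \<longleftrightarrow> t ! j < t ! i"
      using x(3)[OF j(1)] open_gap_less_gap[of "m - i + j" r x] j lr by simp
    then show "drop (m - i) (open_gap x r) ! j < x \<longleftrightarrow> take i t ! j < t ! i"
      using j lr by simp
    have "open_gap x r ! (m - i + j) \<noteq> x"
      using gap_notin_open_gap[of x r] nth_mem[of "m - i + j" "open_gap x r"] j lr by fastforce
    moreover have "t ! j \<noteq> t ! i"
      using perm_nth_eq_iff[OF assms(2), of j i] j Suc.prems by simp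
    ultimately show "x < drop (m - i) (open_gap x r) ! j \<longleftrightarrow> t ! i < take i t ! j"
      using less j lr by auto
  qed
  with 1 have "same_order (drop (m - Suc i) (arc_target a)) (take i t @ [t ! i])"
    by (rule same_order_trans)
  then have "same_order (drop (m - Suc i) (arc_target a)) (take (Suc i) t)"
    using lt Suc.prems by (simp add: take_Suc_conv_app_nth)
  moreover have "s \<rightarrow>\<^sup>*\<^bsub>overlap_graph\<^esub> arc_target a"
    using r(1) dominates_arc[OF a(1)] a(2) by (auto intro: reachable_adj_trans)
  ultimately show ?case by blast
qed

lemma connected_overlap_graph: "connected overlap_graph"
proof (rule connectedI)
  have "is_perm m [1..<Suc m]" by (auto simp: is_perm_def)
  then show "verts overlap_graph \<noteq> {}"
    unfolding overlap_graph_sel by blast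
next
  fix s t assume "s \<in> verts overlap_graph" "t \<in> verts overlap_graph"
  then have st: "is_perm m s" "is_perm m t" by auto
  from reachable_suffix[OF this le_refl] obtain r
    where r: "s \<rightarrow>\<^sup>*\<^bsub>overlap_graph\<^esub> r" "same_order r t"
    using st by (auto simp: is_perm_def)
  moreover have "is_perm m r"
    using r(1) by (auto elim: reachable_in_vertsE)
  ultimately have "s \<rightarrow>\<^sup>*\<^bsub>overlap_graph\<^esub> t"
    using same_order_perm_imp_eq st by blast
  \<comment> \<open>\<open>connected\<close> refers to the symmetric closure; directed reachability
    implies it.\<close>
  then show "s \<rightarrow>\<^sup>*\<^bsub>with_proj (mk_symmetric overlap_graph)\<^esub> t"
    by (rule reachable_mk_symmetricI)
qed

section \<open>From trails to words\<close>

text \<open>In a tied arc the only relation between the ends is suppressed, so the first and last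
  letters of \<open>w\<close> are equal.\<close>

definition realizes :: "nat list \<Rightarrow> nat list \<Rightarrow> bool" where
  "realizes w a \<longleftrightarrow> length w = Suc m \<and>
     (\<forall>i \<le> m. \<forall>j \<le> m. w ! i < w ! j \<longleftrightarrow> a ! i < a ! j \<and> \<not> (tied a \<and> i = 0 \<and> j = m))"

lemma realizes_map_double [simp]: "realizes (map ((*) 2) w) a \<longleftrightarrow> realizes w a"
  by (auto simp: realizes_def)

lemma realizes_snocI:
  assumes "length v = m"
    and "\<And>i j. i < m \<Longrightarrow> j < m \<Longrightarrow> v ! i < v ! j \<longleftrightarrow> a ! i < a ! j"
    and "\<And>i. i < m \<Longrightarrow> v ! i < c \<longleftrightarrow> a ! i < a ! m \<and> \<not> (tied a \<and> i = 0)"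
    and "\<And>i. i < m \<Longrightarrow> c < v ! i \<longleftrightarrow> a ! m < a ! i"
  shows "realizes (v @ [c]) a"
  using assms m_pos by (auto simp: realizes_def nth_append le_less)

text \<open>A tie concerns the two ends only; this yields the distance condition on equal
  letters.\<close>

lemma realizes_nth_neq:
  assumes "realizes w a" "is_perm (Suc m) a" "0 < i" "i < m"
  shows "w ! i \<noteq> w ! m"
proof -
  have "a ! i \<noteq> a ! m"
    using perm_nth_eq_iff[OF assms(2), of i m] assms(4) by simp
  moreover have "w ! i < w ! m \<longleftrightarrow> a ! i < a ! m" "w ! m < w ! i \<longleftrightarrow> a ! m < a ! i"
    using assms by (auto simp: realizes_def)
  ultimately show ?thesis by auto
qed

text \<open>Removing the first letter removes the only pair whose order may differ from that in
  \<open>a\<close>, so the walk can continue from the target.\<close>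

lemma realizes_tl_same_order:
  assumes "realizes w a" "is_perm (Suc m) a"
  shows "same_order (tl w) (arc_target a)"
proof -
  have "length a = Suc m" using assms(2) by (simp add: is_perm_def)
  then have "same_order (tl w) (tl a)"
    using assms(1) by (auto simp: same_order_def realizes_def nth_tl)
  moreover have "hd a \<notin> set (tl a)"
    using assms(2) by (cases a) (auto simp: is_perm_def)
  then have "same_order (tl a) (arc_target a)"
    unfolding arc_target_def by (intro same_order_sym[OF same_order_close_gap])
  ultimately show ?thesis
    by (rule same_order_trans)
qed

text \<open>Doubling the letters makes room for an odd new letter in every gap.\<close>

lemma realizes_extend:
  assumes a: "is_perm (Suc m) a" and w: "same_order w (arc_source a)"
    and pos: "\<And>x. x \<in> set w \<Longrightarrow> 0 < x"
  shows "\<exists>c > 0. realizes (map ((*) 2) w @ [c]) a"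
proof -
  obtain s x where s: "is_perm m s" "a = open_gap x s @ [x]" "arc_source a = s"
    using perm_arc_source_iff[of m a "arc_source a"] a by auto
  then have ls: "length s = m" by (simp add: is_perm_def)
  have lw: "length w = m" using w s(3) ls by (simp add: same_order_def)
  have am: "a ! m = x" and ai: "\<And>i. i < m \<Longrightarrow> a ! i = open_gap x s ! i"
    using ls by (simp_all add: s(2) nth_append)
  have wa: "w ! i < w ! j \<longleftrightarrow> a ! i < a ! j" if "i < m" "j < m" for i j
    using w that ls lw ai open_gap_less[of i s j x] by (simp add: same_order_def s(3))
  have neq: "a ! i \<noteq> a ! m" if "i < m" for i
    using perm_nth_eq_iff[OF a, of i m] that by simp
  show ?thesis
  proof (cases "tied a")
    case True
    have "a \<noteq> []" using s(2) by simp
    then have last: "a ! m = Suc (a ! 0)"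
      using True s(2) am by (simp add: tied_def hd_conv_nth)
    \<comment> \<open>Repeating the first letter is right: the ends of \<open>a\<close> are
      consecutive values, so they compare alike with every inner letter.\<close>
    have "realizes (map ((*) 2) w @ [2 * w ! 0]) a"
    proof (rule realizes_snocI)
      fix i assume i: "i < m"
      have "a ! i \<noteq> a ! 0" if "i \<noteq> 0"
        using perm_nth_eq_iff[OF a, of i 0] i that by simp
      then show "map ((*) 2) w ! i < 2 * w ! 0 \<longleftrightarrow> a ! i < a ! m \<and> \<not> (tied a \<and> i = 0)"
        using wa[OF i m_pos] last True i lw by (cases "i = 0") auto
      show "2 * w ! 0 < map ((*) 2) w ! i \<longleftrightarrow> a ! m < a ! i"
        using wa[OF m_pos i] last neq[OF i] i lw by auto
    qed (use lw wa in auto)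
    moreover have "0 < 2 * w ! 0"
      using pos lw m_pos by simp
    ultimately show ?thesis by blast
  next
    case False
    have "\<And>y. y \<in> set w \<Longrightarrow> 0 < y \<and> y \<le> Max (set w)"
      using pos by simp
    from same_order_threshold[OF w this, of x]
    \<comment> \<open>The new letter will be \<open>2 * y - 1\<close>, which separates the doubles
      of the letters below \<open>y\<close> from those of the others.\<close>
    obtain y where y: "0 < y" "\<And>i. i < m \<Longrightarrow> w ! i < y \<longleftrightarrow> s ! i < x"
      using lw s(3) by auto
    have "realizes (map ((*) 2) w @ [2 * y - 1]) a"
    proof (rule realizes_snocI)
      fix i assume i: "i < m"
      have *: "w ! i < y \<longleftrightarrow> a ! i < a ! m"
        using y(2)[OF i] open_gap_less_gap[of i s x] ls ai[OF i] am i by simp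
      have "2 * w ! i < 2 * y - 1 \<longleftrightarrow> w ! i < y" "2 * y - 1 < 2 * w ! i \<longleftrightarrow> \<not> w ! i < y"
        using y(1) by auto
      then show "map ((*) 2) w ! i < 2 * y - 1 \<longleftrightarrow> a ! i < a ! m \<and> \<not> (tied a \<and> i = 0)"
        "2 * y - 1 < map ((*) 2) w ! i \<longleftrightarrow> a ! m < a ! i"
        using * False neq[OF i] i lw by auto
    qed (use lw wa in auto)
    then show ?thesis
      using y(1) by (intro exI[of _ "2 * y - 1"]) auto
  qed
qed

text \<open>Induction along the walk. The invariant that the last \<open>m\<close> letters have the
  pattern of the current vertex allows the next arc to be appended.\<close>

lemma word_of_walk:
  assumes "cas s p t" "set p \<subseteq> arcs overlap_graph" "is_perm m s"
  shows "\<exists>u. length u = m + length p \<and> (\<forall>x \<in> set u. 0 < x) \<and> incomp_dist (Suc m) u \<and>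
    same_order (drop (length p) u) t \<and> (\<forall>i < length p. realizes (factor u (Suc m) i) (p ! i))"
  using assms(1,2)
proof (induction p arbitrary: t rule: rev_induct)
  case Nil
  then show ?case
    using assms(3)
    \<comment> \<open>The start vertex, read as a word, serves the empty walk; its letters are
      distinct.\<close>
    by (intro exI[of _ s]) (auto simp: is_perm_def incomp_dist_def same_order_def nth_eq_iff_index_eq)
next
  case (snoc a p)
  let ?l = "length p"
  have a: "is_perm (Suc m) a" "arc_target a = t" "cas s p (arc_source a)" "set p \<subseteq> arcs overlap_graph"
    using snoc.prems by auto
  from snoc.IH[OF a(3,4)] obtain u where u: "length u = m + ?l" "\<And>x. x \<in> set u \<Longrightarrow> 0 < x"
    "incomp_dist (Suc m) u" "same_order (drop ?l u) (arc_source a)"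
    "\<And>i. i < ?l \<Longrightarrow> realizes (factor u (Suc m) i) (p ! i)"
    by auto
  define w where "w = drop ?l u"
  have "\<And>x. x \<in> set w \<Longrightarrow> 0 < x"
    using u(2) set_drop_subset[of ?l u] by (auto simp: w_def)
  from realizes_extend[OF a(1) _ this] u(4)
  obtain c where c: "0 < c" "realizes (map ((*) 2) w @ [c]) a"
    by (auto simp: w_def)
  define v where "v = map ((*) 2) u @ [c]"
  have drop_v: "drop ?l v = map ((*) 2) w @ [c]"
    using u(1) by (simp add: v_def w_def drop_map)
  have "m \<le> j - i" if ij: "i < j" "j < length v" "v ! i = v ! j" for i j
  proof (cases "j < length u")
    case True
    then have "u ! i = u ! j"
      using ij by (simp add: v_def nth_append)
    then show ?thesis
      using u(3) True ij(1) by (auto simp: incomp_dist_def)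
  next
    case False
    then have j: "j = ?l + m"
      using ij(2) u(1) by (simp add: v_def)
    show ?thesis
    proof (rule ccontr)
      assume "\<not> m \<le> j - i"
      \<comment> \<open>Position \<open>i\<close> then lies strictly inside the last factor, where
        no letter equals the new one.\<close>
      then have "0 < i - ?l" "i - ?l < m" "?l + (i - ?l) = i"
        using j ij(1) by auto
      then have "drop ?l v ! (i - ?l) \<noteq> drop ?l v ! m"
        using realizes_nth_neq[OF c(2) a(1)] by (simp add: drop_v)
      then show False
        using ij(2,3) \<open>?l + (i - ?l) = i\<close> j by simp
    qed
  qed
  then have "incomp_dist (Suc m) v"
    by (simp add: incomp_dist_def)
  moreover have "same_order (drop (length (p @ [a])) v) t"
    using realizes_tl_same_order[OF c(2) a(1)] by (simp add: a(2) drop_v[symmetric] drop_Suc tl_drop)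
  moreover have "realizes (factor v (Suc m) i) ((p @ [a]) ! i)" if "i < length (p @ [a])" for i
  proof (cases "i < ?l")
    case True
    then have "factor v (Suc m) i = map ((*) 2) (factor u (Suc m) i)"
      using u(1) by (simp add: factor_def v_def take_map drop_map)
    then show ?thesis
      using u(5)[OF True] True by (simp add: nth_append)
  next
    case False
    then have "i = ?l" using that by simp
    then have "factor v (Suc m) i = map ((*) 2) w @ [c]"
      using u(1) by (simp add: factor_def drop_v) (simp add: w_def)
    then show ?thesis
      using c(2) \<open>i = ?l\<close> by simp
  qed
  moreover have "length v = m + length (p @ [a])" "\<forall>x \<in> set v. 0 < x"
    using u(1,2) c(1) by (auto simp: v_def)
  ultimately show ?case by blast
qed

section \<open>Permutations covered by a factor\<close>

text \<open>The factor imposes every relation of \<open>a\<close> except possibly the one between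
  its ends. These are then consecutive values, so exchanging them is the only freedom.\<close>

lemma covers_realizes_iff:
  assumes r: "realizes w a" and a: "is_perm (Suc m) a" and q: "is_perm (Suc m) q"
  shows "covers w q \<longleftrightarrow> q = a \<or> tied a \<and> q = swap_ends a"
proof -
  have len: "length w = Suc m" "length q = Suc m" "length a = Suc m"
    using r q a by (auto simp: realizes_def is_perm_def)
  have cov: "covers w q \<longleftrightarrow> (\<forall>i \<le> m. \<forall>j \<le> m. a ! i < a ! j \<and> \<not> (tied a \<and> i = 0 \<and> j = m) \<longrightarrow> q ! i < q ! j)"
    using r len by (auto simp: covers_def realizes_def less_Suc_eq_le)
  have sw: "is_perm (Suc m) (swap_ends a)" "length (swap_ends a) = Suc m"
    using is_perm_swap_ends[OF a m_pos] by (auto simp: is_perm_def)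
  note nth = nth_swap_ends[OF a m_pos]
  have neq: "a ! i \<noteq> a ! j" if "i \<le> m" "j \<le> m" "i \<noteq> j" for i j
    using perm_nth_eq_iff[OF a, of i j] that by simp
  have last: "a ! m = Suc (a ! 0)" if "tied a"
  proof -
    have "a \<noteq> []" using len(3) by auto
    then show ?thesis using that len(3) by (simp add: tied_def hd_conv_nth last_conv_nth)
  qed
  show ?thesis
  proof
    assume "covers w q"
    then have c: "q ! i < q ! j" if "i \<le> m" "j \<le> m" "a ! i < a ! j" "\<not> (tied a \<and> i = 0 \<and> j = m)" for i j
      using cov that by blast
    show "q = a \<or> tied a \<and> q = swap_ends a"
    \<comment> \<open>Either \<open>q\<close> satisfies the order of the ends in \<open>a\<close> as
      well, or it reverses it and so satisfies all relations of \<open>swap_ends a\<close>.\<close>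
    proof (cases "tied a \<and> q ! m < q ! 0")
      case False
      have "q ! 0 \<noteq> q ! m"
        using perm_nth_eq_iff[OF q, of 0 m] m_pos by simp
      then have "q ! i < q ! j" if "i \<le> m" "j \<le> m" "a ! i < a ! j" for i j
        using c[OF that] False by (cases "tied a \<and> i = 0 \<and> j = m") auto
      then have "covers a q"
        using len by (simp add: covers_def less_Suc_eq_le)
      then show ?thesis
        using covers_perm_imp_eq[OF a q] by simp
    next
      case True
      have "swap_ends a ! i < swap_ends a ! j \<Longrightarrow> q ! i < q ! j" if ij: "i \<le> m" "j \<le> m" for i j
        using True last c[OF ij] c[of 0 j] c[of i 0] c[of m j] c[of i m] nth[OF ij(1)] nth[OF ij(2)]
          neq[of i 0] neq[of j m] ij m_pos
        by (auto split: if_splits)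
      then have "covers (swap_ends a) q"
        using len sw(2) by (auto simp: covers_def less_Suc_eq_le)
      then show ?thesis
        using covers_perm_imp_eq[OF sw(1) q] True by simp
    qed
  next
    assume "q = a \<or> tied a \<and> q = swap_ends a"
    then show "covers w q"
    proof
      assume *: "tied a \<and> q = swap_ends a"
      have "swap_ends a ! i < swap_ends a ! j"
        if ij: "i \<le> m" "j \<le> m" and "a ! i < a ! j" "\<not> (tied a \<and> i = 0 \<and> j = m)" for i j
        using that * last nth[OF ij(1)] nth[OF ij(2)] neq[of i 0] neq[of j m] neq[of i m] neq[of j 0] m_pos
        by (auto split: if_splits)
      with * cov show ?thesis by auto
    qed (use cov in auto)
  qed
qed

text \<open>Names the unique kept arc responsible for \<open>q\<close>: its twin if \<open>q\<close>
  was merged away, otherwise \<open>q\<close> itself.\<close>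

lemma arc_covering_iff:
  assumes q: "is_perm (Suc m) q" and a: "is_perm (Suc m) a" "\<not> merged a"
  shows "q = a \<or> tied a \<and> q = swap_ends a \<longleftrightarrow> a = (if merged q then swap_ends q else q)"
proof (cases "merged q")
  case True
  then have adj: "hd q = Suc (last q)" "arc_source q \<in> M" by (auto simp: merged_def)
  then have "tied (swap_ends q)"
    using swap_ends_adjacent[OF q m_pos adj(1)] by (simp add: tied_def)
  then show ?thesis
    using True a swap_swap_ends[OF q m_pos] swap_swap_ends[OF a(1) m_pos] by auto
next
  case False
  have "\<not> (tied a \<and> q = swap_ends a)"
  proof
    assume *: "tied a \<and> q = swap_ends a"
    then have "hd q = Suc (last q)" by (simp add: tied_def)
    moreover have "swap_ends q = a"
      using * swap_swap_ends[OF a(1) m_pos] by simp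
    ultimately have "merged q"
      using swap_ends_adjacent(1)[OF q m_pos] * by (simp add: merged_def tied_def)
    with False show False by simp
  qed
  with False show ?thesis by auto
qed

theorem ex_uword:
  "\<exists>u. is_uword (Suc m) u \<and> incomp_dist (Suc m) u \<and> length u + card M = fact (Suc m) + m"
proof -
  obtain s p where "euler_trail s p s"
    \<comment> \<open>In- and out-degrees are given by the same formula, so the graph is
      balanced.\<close>
    using closed_euler1[OF connected_overlap_graph] in_degree_overlap_graph out_degree_overlap_graph by auto
  then have p: "cas s p s" "set p = arcs overlap_graph" "is_perm m s" "distinct p"
    by (auto simp: euler_trail_def trail_def awalk_def)
  from word_of_walk[OF p(1) _ p(3)] p(2)
  obtain u where u: "length u = m + length p" "\<forall>x \<in> set u. 0 < x" "incomp_dist (Suc m) u"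
    "\<And>i. i < length p \<Longrightarrow> realizes (factor u (Suc m) i) (p ! i)"
    by auto
  have card: "length p = card (arcs overlap_graph)"
    using p(2,4) by (metis distinct_card)
  have "p \<noteq> []"
    using p(2) arcs_nonempty by auto
  then have lp: "0 < length p" by simp
  have "\<exists>!i. i \<le> length u - Suc m \<and> covers (factor u (Suc m) i) q" if q: "is_perm (Suc m) q" for q
  proof -
    define b where "b = (if merged q then swap_ends q else q)"
    have "\<not> merged (swap_ends q)" if "merged q"
      using that by (simp add: merged_def)
    then have "b \<in> set p"
      using q is_perm_swap_ends[OF q m_pos] by (auto simp: p(2) b_def)
    \<comment> \<open>The trail uses every kept arc exactly once.\<close>
    then have "\<exists>!i. i < length p \<and> p ! i = b"
      using p(4) by (auto simp: in_set_conv_nth nth_eq_iff_index_eq)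
    moreover have "covers (factor u (Suc m) i) q \<longleftrightarrow> p ! i = b" if i: "i < length p" for i
    proof -
      have "p ! i \<in> arcs overlap_graph"
        using nth_mem[OF i] p(2) by simp
      then have "is_perm (Suc m) (p ! i)" "\<not> merged (p ! i)" by auto
      then show ?thesis
        using covers_realizes_iff[OF u(4)[OF i] _ q] arc_covering_iff[OF q] by (simp add: b_def)
    qed
    moreover have "i \<le> length u - Suc m \<longleftrightarrow> i < length p" for i
      unfolding u(1) using lp by linarith
    ultimately show ?thesis by metis
  qed
  moreover have "Suc m \<le> length u"
    using u(1) lp by linarith
  ultimately have "is_uword (Suc m) u"
    unfolding is_uword_def using u(2) by blast
  moreover have "length u + card M = fact (Suc m) + m"
    using card_arcs card u(1) by linarith
  ultimately show ?thesis
    using u(3) by blast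
qed

end

section \<open>Choosing the rotation classes\<close>

text \<open>The common first letter occurs only once in each word, and its position after rotation
  reveals the amount of rotation.\<close>

lemma rotate_inj_hd:
  assumes "is_perm m r" "is_perm m r'" "hd r = hd r'" "i < m" "j < m" "rotate i r = rotate j r'"
  shows "i = j"
proof -
  have l: "length r = m" "length r' = m" "r \<noteq> []" "r' \<noteq> []"
    using assms by (auto simp: is_perm_def)
  have "rotate (m - j + i) r = rotate (m - j + j) r'"
    using assms(6) by (simp only: rotate_rotate[symmetric])
  then have "rotate (m - j + i) r = r'"
    using assms(5) l by simp
  then have "r ! ((m - j + i) mod m) = r ! 0"
    using assms(3) l by (metis hd_rotate_conv_nth hd_conv_nth)
  then have "(m - j + i) mod m = 0"
    using perm_nth_eq_iff[OF assms(1), of "(m - j + i) mod m" 0] assms(4) by simp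
  \<comment> \<open>The only multiple of \<open>m\<close> strictly between 0 and
    \<open>2 * m\<close> is \<open>m\<close> itself.\<close>
  moreover have "m - j + i < 2 * m" "0 < m - j + i"
    using assms(4,5) by auto
  ultimately have "m - j + i = m"
    by (cases "m - j + i < m") (auto simp: le_mod_geq)
  then show ?thesis
    using assms(5) by simp
qed

text \<open>The permutations starting with 1 represent the rotation classes, one for each
  class.\<close>

lemma card_perms_hd_1:
  assumes "0 < m"
  shows "card {p. is_perm m p \<and> hd p = 1} = fact (m - 1)"
proof -
  have "{p. is_perm m p \<and> hd p = 1} = (#) 1 ` permutations_of_set {2..m}"
  proof (intro equalityI subsetI)
    fix p assume "p \<in> {p. is_perm m p \<and> hd p = 1}"
    then have p: "is_perm m p" "hd p = 1" by auto
    then obtain xs where xs: "p = 1 # xs"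
      using assms by (cases p) (auto simp: is_perm_def)
    then have "distinct xs" "1 \<notin> set xs" "insert 1 (set xs) = {1..m}"
      using p by (auto simp: is_perm_def)
    moreover from this have "set xs = {1..m} - {1}" by blast
    moreover have "{1..m} - {1} = {2..m}" by auto
    ultimately show "p \<in> (#) 1 ` permutations_of_set {2..m}"
      using xs by (auto simp: permutations_of_set_def)
  next
    fix p assume "p \<in> (#) 1 ` permutations_of_set {2..m}"
    then obtain xs where xs: "p = 1 # xs" "set xs = {2..m}" "distinct xs"
      by (auto simp: permutations_of_set_def)
    have "set p = {1..m}" using xs assms by auto
    moreover have "distinct p" using xs by auto
    ultimately show "p \<in> {p. is_perm m p \<and> hd p = 1}"
      using xs(1) distinct_card[of p] by (simp add: is_perm_def)
  qed
  then show ?thesis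
    by (simp add: card_image)
qed

lemma ex_tie_classes:
  assumes "0 < m" "k \<le> fact (m - 1)"
  shows "\<exists>M. tie_classes m M \<and> card M = k * m"
proof -
  obtain S where S: "S \<subseteq> {p. is_perm m p \<and> hd p = 1}" "card S = k"
    using assms obtain_subset_with_card_n[of k "{p. is_perm m p \<and> hd p = 1}"]
    by (metis card_perms_hd_1)
  \<comment> \<open>All rotations of \<open>k\<close> chosen representatives.\<close>
  define M where "M = (\<lambda>(i, r). rotate i r) ` ({..<m} \<times> S)"
  have perm: "is_perm m r" if "r \<in> S" for r
    using S(1) that by auto
  have rot: "rotate i r \<in> M" if "r \<in> S" for i r
  proof -
    have "rotate i r = rotate (i mod m) r"
      using rotate_conv_mod[of i r] perm[OF that] by (simp add: is_perm_def)
    then show ?thesis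
      using that assms(1) by (auto simp: M_def)
  qed
  have fwd: "rotate1 s \<in> M" if "s \<in> M" for s
  proof -
    obtain i r where "r \<in> S" "s = rotate i r" using \<open>s \<in> M\<close> by (auto simp: M_def)
    then show ?thesis using rot[of r "Suc i"] by simp
  qed
  have pM: "is_perm m s" if "s \<in> M" for s
    using that perm by (auto simp: M_def is_perm_def)
  \<comment> \<open>Rotating \<open>m\<close> times is the identity, so closure under rotation also
    holds backwards.\<close>
  have bwd: "s \<in> M" if "rotate1 s \<in> M" for s
  proof -
    have "(rotate1 ^^ j) (rotate1 s) \<in> M" for j
      by (induction j) (use that fwd in auto)
    then have "rotate (m - 1) (rotate1 s) \<in> M"
      by (simp add: rotate_def)
    moreover have "rotate (m - 1) (rotate1 s) = rotate m s"
      using assms(1) by (metis Suc_diff_1 rotate1_rotate_swap rotate_Suc)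
    moreover have "length s = m" using pM[OF that] by (simp add: is_perm_def)
    ultimately show ?thesis by simp
  qed
  have "inj_on (\<lambda>(i, r). rotate i r) ({..<m} \<times> S)"
  proof (rule inj_onI)
    fix x y
    assume xy: "x \<in> {..<m} \<times> S" "y \<in> {..<m} \<times> S" "(\<lambda>(i, r). rotate i r) x = (\<lambda>(i, r). rotate i r) y"
    obtain i r j r' where x: "x = (i, r)" and y: "y = (j, r')" by (cases x, cases y)
    have *: "r \<in> S" "r' \<in> S" "i < m" "j < m" "rotate i r = rotate j r'"
      using xy by (simp_all add: x y)
    then have "i = j"
      using rotate_inj_hd[OF perm perm, of r r' i j] subsetD[OF S(1)] by simp
    moreover have "inj (rotate i)"
      unfolding rotate_def by (intro inj_fn inj_rotate1)
    ultimately show "x = y"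
      using *(5) by (auto simp: x y dest: injD)
  qed
  then have "card M = k * m"
    by (simp add: M_def card_image card_cartesian_product S(2))
  moreover have "tie_classes m M"
    by unfold_locales (use assms(1) pM fwd bwd in blast)+
  ultimately show ?thesis by blast
qed

theorem theorem1:
  fixes n k :: nat
  assumes "n \<ge> 2" and "k \<le> fact (n - 2)"
  shows "\<exists>u. is_uword n u \<and> incomp_dist n u \<and>
           int (length u) = int (fact n) + (1 - int k) * (int n - 1)"
proof -
  define m where "m = n - 1"
  have m: "0 < m" "n = Suc m" "k \<le> fact (m - 1)"
    using assms by (auto simp: m_def numeral_2_eq_2)
  obtain M where M: "tie_classes m M" "card M = k * m"
    using ex_tie_classes[OF m(1,3)] by blast
  obtain u where u: "is_uword n u" "incomp_dist n u" "length u + k * m = fact n + m"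
    using tie_classes.ex_uword[OF M(1)] M(2) m(2) by auto
  \<comment> \<open>The passage to integers matters because \<open>1 - k\<close> is negative for
    \<open>k > 1\<close>.\<close>
  have "int (length u) + int k * int m = int (fact n) + int m"
    using u(3) by (metis of_nat_add of_nat_mult)
  then have "int (length u) = int (fact n) + (1 - int k) * (int n - 1)"
    by (simp add: m(2) algebra_simps)
  with u show ?thesis by blast
qed

end
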